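(* Let $\alpha,\gamma,\kappa>-1$ be real numbers with $\alpha+\kappa>-\frac32$, and let $\{p_{n,k}^{\alpha,\gamma,\kappa}(x,y):\ n,k\in\mathbb{N}_0\}$ be the monic symmetric orthogonal basis associated with $w_{\alpha,\gamma,\kappa}$. Then, for all $n,k\in\mathbb{N}_0$, \[ \mathcal{D}_{2}^{\alpha,\kappa}\big[p_{n,k}^{\alpha,\gamma,\kappa}(x,y)\big]=4k(k+\alpha+\kappa+1)\,p_{n,k}^{\alpha,\gamma,\kappa}(x,y), \] where $\mathcal{D}_{2}^{\alpha,\kappa}:=D_{+}^{\alpha,\kappa}D_{-}$.
   Context: All polynomials have real coefficients; symmetric means invariant under interchange of $x$ and $y$. Let $\mathbf{T}^2=\{(x,y)\in\mathbb{R}^2:\ x\ge0,\ y\ge0,\ x+y\le1\}$, $\triangle=\{(x,y)\in\mathbf{T}^2:\ y<x\}$, and \[ w_{\alpha,\gamma,\kappa}(x,y)=(xy)^{\alpha}(1-x-y)^{\gamma}|x-y|^{2\kappa+1}. \] Order on $\mathbb{N}_0^2$ (with $\mathbb{N}_0$ the nonnegative integers): $(m,l)\prec(n,k)$ if and only if $m+2l<n+2k$, or $m+2l=n+2k$ and $l<k$; this is a strict total order. Every symmetric polynomial is uniquely a finite linear combination of the monomials $(x+y)^n(xy)^k$; the largest pair $(n,k)$ (for $\prec$) occurring with nonzero coefficient is its symmetric degree. Monic orthogonal basis: $p_{n,k}^{\alpha,\gamma,\kappa}$ is obtained by Gram--Schmidt (without normalization of norms, with leading coefficient $1$) from the monomials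 $(x+y)^n(xy)^k$ ordered by $\prec$; i.e. it is the unique symmetric polynomial equal to $(x+y)^n(xy)^k$ plus a linear combination of $(x+y)^m(xy)^l$ with $(m,l)\prec(n,k)$, and satisfying $\int_{\triangle}p_{n,k}^{\alpha,\gamma,\kappa}\,q\,w_{\alpha,\gamma,\kappa}\,dx\,dy=0$ for every symmetric polynomial $q$ of symmetric degree $\prec(n,k)$. Operators: \[ D_{-}:=\frac{\partial_y-\partial_x}{x-y},\qquad D_{+}^{\alpha,\kappa}:=\frac{-1}{(xy)^\alpha(x-y)^{2\kappa}}D_{-}\left[(xy)^{\alpha+1}(x-y)^{2\kappa+2}\,\cdot\right], \] the latter being equal to $D_{+}^{\alpha,\kappa}=xy(x-y)(\partial_x-\partial_y)+4(\kappa+1)xy-(\alpha+1)(x-y)^2$. For $f$ a symmetric polynomial, $(\partial_y-\partial_x)f$ is divisible by $x-y$, so $D_-f$ is a (symmetric) polynomial. *)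

theory Defs
  imports "HOL-Analysis.Analysis" "HOL-Computational_Algebra.Computational_Algebra"
begin

text \<open>
  Bivariate real polynomials are elements of \<open>real poly poly\<close>, read as \<open>\<real>[x][y]\<close>: the inner
  variable is \<open>x\<close>, the outer one is \<open>y\<close>.
\<close>

definition varX :: "real poly poly" where "varX = [:[:0, 1:]:]"
definition varY :: "real poly poly" where "varY = [:0, 1:]"

definition scale :: "real \<Rightarrow> real poly poly \<Rightarrow> real poly poly" where
  "scale a p = smult [:a:] p"

definition eval2 :: "real poly poly \<Rightarrow> real \<Rightarrow> real \<Rightarrow> real" where
  "eval2 p x y = poly (poly p [:y:]) x"

definition dX :: "real poly poly \<Rightarrow> real poly poly" where
  "dX p = map_poly pderiv p"

definition dY :: "real poly poly \<Rightarrow> real poly poly" where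
  "dY p = pderiv p"

definition sym_poly :: "real poly poly \<Rightarrow> bool" where
  "sym_poly p \<longleftrightarrow> (\<forall>x y. eval2 p x y = eval2 p y x)"

definition T2 :: "(real \<times> real) set" where
  "T2 = {(x, y). x \<ge> 0 \<and> y \<ge> 0 \<and> x + y \<le> 1}"

definition triangle :: "(real \<times> real) set" where
  "triangle = {(x, y). (x, y) \<in> T2 \<and> y < x}"

definition weight :: "real \<Rightarrow> real \<Rightarrow> real \<Rightarrow> real \<times> real \<Rightarrow> real" where
  "weight \<alpha> \<gamma> \<kappa> = (\<lambda>(x, y).
     (x * y) powr \<alpha> * (1 - x - y) powr \<gamma> * \<bar>x - y\<bar> powr (2 * \<kappa> + 1))"

definition inner_w :: "real \<Rightarrow> real \<Rightarrow> real \<Rightarrow> real poly poly \<Rightarrow> real poly poly \<Rightarrow> real" where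
  "inner_w \<alpha> \<gamma> \<kappa> p q =
     (LINT z:triangle|lborel. eval2 p (fst z) (snd z) * eval2 q (fst z) (snd z) * weight \<alpha> \<gamma> \<kappa> z)"

definition prec :: "nat \<times> nat \<Rightarrow> nat \<times> nat \<Rightarrow> bool" (infix \<open>\<prec>\<^sub>s\<close> 50) where
  "a \<prec>\<^sub>s b \<longleftrightarrow> fst a + 2 * snd a < fst b + 2 * snd b \<or>
             (fst a + 2 * snd a = fst b + 2 * snd b \<and> snd a < snd b)"

definition sym_mono :: "nat \<times> nat \<Rightarrow> real poly poly" where
  "sym_mono a = (varX + varY) ^ fst a * (varX * varY) ^ snd a"

text \<open>The zero polynomial has no symmetric degree.\<close>

definition has_sym_degree :: "real poly poly \<Rightarrow> nat \<times> nat \<Rightarrow> bool" where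
  "has_sym_degree q d \<longleftrightarrow>
     (\<exists>c. finite {a. c a \<noteq> 0} \<and> q = (\<Sum>a | c a \<noteq> 0. scale (c a) (sym_mono a)) \<and>
          c d \<noteq> 0 \<and> (\<forall>a. c a \<noteq> 0 \<longrightarrow> a = d \<or> a \<prec>\<^sub>s d))"

definition is_monic_orthogonal ::
  "real \<Rightarrow> real \<Rightarrow> real \<Rightarrow> nat \<times> nat \<Rightarrow> real poly poly \<Rightarrow> bool" where
  "is_monic_orthogonal \<alpha> \<gamma> \<kappa> d p \<longleftrightarrow>
     sym_poly p \<and>
     (\<exists>c. p = sym_mono d + (\<Sum>a | a \<prec>\<^sub>s d. scale (c a) (sym_mono a))) \<and>
     (\<forall>q e. sym_poly q \<longrightarrow> has_sym_degree q e \<longrightarrow> e \<prec>\<^sub>s d \<longrightarrow> inner_w \<alpha> \<gamma> \<kappa> p q = 0)"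

text \<open>The sum in \<open>is_monic_orthogonal\<close> is a genuine finite sum.\<close>

lemma finite_prec: "finite {a. a \<prec>\<^sub>s d}"
proof (rule finite_subset)
  show "{a. a \<prec>\<^sub>s d} \<subseteq> {..fst d + 2 * snd d} \<times> {..fst d + 2 * snd d}"
    by (auto simp: prec_def)
qed auto

text \<open>
  The quotient below is exact on symmetric polynomials (lemma \<open>D_minus_exact\<close>); \<open>div\<close> has no
  meaning of interest on other polynomials.
\<close>

definition D_minus :: "real poly poly \<Rightarrow> real poly poly" where
  "D_minus f = (dY f - dX f) div (varX - varY)"

text \<open>
  The polynomial form of \<open>D\<^sub>+\<close>; lemma \<open>D_plus_weighted_form\<close> shows that it agrees with
  \<open>-1 / ((xy)\<^sup>\<alpha> (x-y)\<^sup>2\<^sup>\<kappa>) D\<^sub>- [(xy)\<^sup>\<alpha>\<^sup>+\<^sup>1 (x-y)\<^sup>2\<^sup>\<kappa>\<^sup>+\<^sup>2 f]\<close>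
  where the real powers make sense.
\<close>

definition D_plus :: "real \<Rightarrow> real \<Rightarrow> real poly poly \<Rightarrow> real poly poly" where
  "D_plus \<alpha> \<kappa> f = varX * varY * (varX - varY) * (dX f - dY f)
     + scale (4 * (\<kappa> + 1)) (varX * varY * f) - scale (\<alpha> + 1) ((varX - varY)\<^sup>2 * f)"

definition D2 :: "real \<Rightarrow> real \<Rightarrow> real poly poly \<Rightarrow> real poly poly" where
  "D2 \<alpha> \<kappa> f = D_plus \<alpha> \<kappa> (D_minus f)"

lemma eval2_simps [simp]:
  "eval2 (p + q) x y = eval2 p x y + eval2 q x y"
  "eval2 (p - q) x y = eval2 p x y - eval2 q x y"
  "eval2 (p * q) x y = eval2 p x y * eval2 q x y"
  "eval2 (p ^ n) x y = eval2 p x y ^ n"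
  "eval2 (scale a p) x y = a * eval2 p x y"
  "eval2 varX x y = x"
  "eval2 varY x y = y"
  by (simp_all add: eval2_def scale_def varX_def varY_def)

lemma dX_pCons: "dX (pCons a p) = pCons (pderiv a) (dX p)"
  by (simp add: dX_def map_poly_pCons)

lemma has_deriv_dX:
  "((\<lambda>t. eval2 f t y) has_field_derivative eval2 (dX f) x y) (at x)"
proof (induction f)
  case 0
  show ?case by (simp add: eval2_def dX_def)
next
  case (pCons a p)
  have e: "eval2 (pCons b q) t y = poly b t + y * eval2 q t y" for b q t
    by (simp add: eval2_def)
  show ?case unfolding dX_pCons e
    by (intro DERIV_add poly_DERIV DERIV_cmult pCons.IH)
qed

lemma has_deriv_dY:
  "((\<lambda>t. eval2 f x t) has_field_derivative eval2 (dY f) x y) (at y)"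
proof (induction f)
  case 0
  show ?case by (simp add: eval2_def dY_def)
next
  case (pCons a p)
  have e: "eval2 (pCons b q) x t = poly b x + t * eval2 q x t" for b q t
    by (simp add: eval2_def)
  have d: "eval2 (dY (pCons a p)) x y = 0 + (1 * eval2 p x y + eval2 (dY p) x y * y)"
    by (simp add: dY_def pderiv_pCons eval2_def)
  show ?case unfolding d unfolding e
    by (intro DERIV_add DERIV_const DERIV_mult DERIV_ident pCons.IH)
qed

lemma D_minus_exact:
  assumes "sym_poly f"
  shows "(varX - varY) * D_minus f = dY f - dX f"
proof -
  have "eval2 (dY f - dX f) x x = 0" for x
  proof -
    have "(\<lambda>t. eval2 f t x) = (\<lambda>t. eval2 f x t)"
      using assms by (auto simp: sym_poly_def)
    with has_deriv_dX[of f x x] have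
      "((\<lambda>t. eval2 f x t) has_field_derivative eval2 (dX f) x x) (at x)" by simp
    with has_deriv_dY[of f x x] have "eval2 (dX f) x x = eval2 (dY f) x x"
      by (rule DERIV_unique[symmetric])
    then show ?thesis by simp
  qed
  moreover have "poly (poly g [:0, 1:]) x = eval2 g x x" for g :: "real poly poly" and x
    by (induction g) (simp_all add: eval2_def)
  ultimately have "\<forall>x. poly (poly (dY f - dX f) [:0, 1:]) x = 0" by simp
  then have "poly (dY f - dX f) [:0, 1:] = 0"
    using poly_all_0_iff_0 by blast
  then have "[:- [:0, 1:], 1:] dvd dY f - dX f"
    by (simp only: poly_eq_0_iff_dvd)
  moreover have "varX - varY = - [:- [:0, 1:], 1:]" by (simp add: varX_def varY_def)
  ultimately have "varX - varY dvd dY f - dX f"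
    by (metis minus_dvd_iff)
  then show ?thesis unfolding D_minus_def by (rule dvd_mult_div_cancel)
qed

lemma D_plus_weighted_form:
  fixes \<alpha> \<kappa> x y :: real and f :: "real poly poly"
  assumes "0 < y" "y < x"
  defines "h \<equiv> \<lambda>s t. (s * t) powr (\<alpha> + 1) * (s - t) powr (2 * \<kappa> + 2) * eval2 f s t"
  shows "eval2 (D_plus \<alpha> \<kappa> f) x y =
    - 1 / ((x * y) powr \<alpha> * (x - y) powr (2 * \<kappa>)) *
      ((deriv (\<lambda>t. h x t) y - deriv (\<lambda>s. h s y) x) / (x - y))"
proof -
  define A where "A = (x * y) powr \<alpha>"
  define B where "B = (x - y) powr (2 * \<kappa>)"
  have pos: "x > 0" "x * y > 0" "x - y > 0" using assms by auto
  have pwA: "(x * y) powr (\<alpha> + 1 - 1) = A" by (simp add: A_def)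
  have AB: "A > 0" "B > 0" using pos by (auto simp: A_def B_def)
  have pw: "(x * y) powr (\<alpha> + 1) = A * (x * y)"
    "(x - y) powr (2 * \<kappa> + 2 - 1) = B * (x - y)"
    "(x - y) powr (2 * \<kappa> + 2) = B * (x - y)\<^sup>2"
    using pos powr_add[of "x - y" "2 * \<kappa>" 1]
    by (simp_all add: A_def B_def powr_add add.commute[of 1])
  have r: "((\<lambda>u. g u powr r) has_field_derivative r * g a powr (r - 1) * g') (at a)"
    if "(g has_field_derivative g') (at a)" "g a > 0" for g :: "real \<Rightarrow> real" and g' r a
    using DERIV_powr[OF that DERIV_const[of r]] that(2)
    by (simp add: powr_diff field_simps)
  have "((\<lambda>s. h s y) has_field_derivative
      (((\<alpha> + 1) * (x * y) powr (\<alpha> + 1 - 1) * y) * (x - y) powr (2 * \<kappa> + 2)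
       + ((2 * \<kappa> + 2) * (x - y) powr (2 * \<kappa> + 2 - 1) * 1) * (x * y) powr (\<alpha> + 1)) * eval2 f x y
      + eval2 (dX f) x y * ((x * y) powr (\<alpha> + 1) * (x - y) powr (2 * \<kappa> + 2))) (at x)"
    unfolding h_def using pos
    by (intro DERIV_mult r has_deriv_dX) (auto intro!: derivative_eq_intros)
  then have dx: "deriv (\<lambda>s. h s y) x =
      (((\<alpha> + 1) * A * y) * (B * (x - y)\<^sup>2)
       + ((2 * \<kappa> + 2) * (B * (x - y))) * (A * (x * y))) * eval2 f x y
      + eval2 (dX f) x y * (A * (x * y) * (B * (x - y)\<^sup>2))"
    unfolding pw pwA by (simp add: DERIV_imp_deriv)
  have "((\<lambda>t. h x t) has_field_derivative
      (((\<alpha> + 1) * (x * y) powr (\<alpha> + 1 - 1) * x) * (x - y) powr (2 * \<kappa> + 2)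
       + ((2 * \<kappa> + 2) * (x - y) powr (2 * \<kappa> + 2 - 1) * (- 1)) * (x * y) powr (\<alpha> + 1)) * eval2 f x y
      + eval2 (dY f) x y * ((x * y) powr (\<alpha> + 1) * (x - y) powr (2 * \<kappa> + 2))) (at y)"
    unfolding h_def using pos
    by (intro DERIV_mult r has_deriv_dY) (auto intro!: derivative_eq_intros)
  then have dy: "deriv (\<lambda>t. h x t) y =
      (((\<alpha> + 1) * A * x) * (B * (x - y)\<^sup>2)
       - ((2 * \<kappa> + 2) * (B * (x - y))) * (A * (x * y))) * eval2 f x y
      + eval2 (dY f) x y * (A * (x * y) * (B * (x - y)\<^sup>2))"
    unfolding pw pwA by (simp add: DERIV_imp_deriv)
  have "deriv (\<lambda>t. h x t) y - deriv (\<lambda>s. h s y) x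
      = - (A * B * (x - y)) * eval2 (D_plus \<alpha> \<kappa> f) x y"
    unfolding dx dy D_plus_def eval2_simps by (simp add: power2_eq_square algebra_simps)
  then show ?thesis
    using AB pos by (simp add: A_def[symmetric] B_def[symmetric])
qed

end

theory Submission
  imports Defs
begin

text \<open>
  In the coordinates \<open>s = x + y\<close>, \<open>t = xy\<close> the operator \<open>D\<^sub>2\<close> sends \<open>s\<^sup>n t\<^sup>k\<close> to
  \<open>4k(k+\<alpha>+\<kappa>+1) s\<^sup>n t\<^sup>k - k(k+\<alpha>) s\<^sup>n\<^sup>+\<^sup>2 t\<^sup>k\<^sup>-\<^sup>1\<close>, so it is triangular for the order of
  symmetric degrees. It involves no \<open>s\<close>-derivative, and on each segment \<open>x + y = s\<close> it is a
  Sturm-Liouville operator, symmetric for the restriction of the weight, so by Fubini it is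
  symmetric for \<open>inner_w\<close>. Hence \<open>D\<^sub>2 p - \<lambda> p\<close>, with \<open>\<lambda>\<close> the diagonal entry, has lower degree
  than \<open>p\<close> and is orthogonal to everything of lower degree, in particular to itself.
\<close>

section \<open>Evaluation of bivariate polynomials\<close>

lemma eval2_0 [simp]: "eval2 0 x y = 0"
  by (simp add: eval2_def)

lemma eval2_sym_mono [simp]: "eval2 (sym_mono (n, k)) x y = (x + y) ^ n * (x * y) ^ k"
  by (simp add: sym_mono_def)

lemma eval2_pCons: "eval2 (pCons a p) x y = poly a x + y * eval2 p x y"
  by (simp add: eval2_def)

lemma continuous_eval2 [continuous_intros]:
  assumes "continuous_on S f" "continuous_on S g"
  shows "continuous_on S (\<lambda>z. eval2 p (f z) (g z))"
proof (induction p)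
  case (pCons a p)
  then show ?case unfolding eval2_pCons by (intro continuous_intros assms)
qed auto

text \<open>An open set contains a product of two infinite sets \<open>A\<close> and
  \<open>B\<close>. For each y in \<open>B\<close> the difference \<open>r\<close>, specialised at
  y, has infinitely many roots in x and so vanishes; hence \<open>r\<close>, as a polynomial over
  \<open>real poly\<close>, has infinitely many constant roots. The version for open sets lets
  values inside the triangle determine a polynomial.\<close>

lemma eval2_eqI_open:
  assumes U: "open U" "U \<noteq> {}"
    and eq: "\<And>x y. (x, y) \<in> U \<Longrightarrow> eval2 p x y = eval2 q x y"
  shows "p = q"
proof -
  obtain a b where "(a, b) \<in> U" using U(2) by auto
  with U(1) obtain A B where AB: "open A" "open B" "a \<in> A" "b \<in> B" "A \<times> B \<subseteq> U"
    by (metis open_prod_def mem_Sigma_iff)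
  have inf: "infinite A" "infinite B"
    using AB finite_imp_not_open by blast+
  define r where "r = p - q"
  have r: "eval2 r x y = 0" if "x \<in> A" "y \<in> B" for x y
    using eq[of x y] AB that by (auto simp: r_def)
  have "poly r [:y:] = 0" if "y \<in> B" for y
  proof (rule ccontr)
    assume "poly r [:y:] \<noteq> 0"
    then have "finite {x. poly (poly r [:y:]) x = 0}" by (rule poly_roots_finite)
    moreover have "A \<subseteq> {x. poly (poly r [:y:]) x = 0}"
      using r that by (auto simp: eval2_def)
    ultimately show False using inf finite_subset by blast
  qed
  then have "(\<lambda>y. [:y:]) ` B \<subseteq> {z. poly r z = 0}" by auto
  moreover have "infinite ((\<lambda>y::real. [:y:]) ` B)"
    using inf by (subst finite_image_iff) (auto simp: inj_on_def)
  ultimately have "r = 0"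
    using poly_roots_finite finite_subset by blast
  then show ?thesis by (simp add: r_def)
qed

lemma eval2_eqI:
  assumes "\<And>x y. eval2 p x y = eval2 q x y"
  shows "p = q"
  by (rule eval2_eqI_open[of UNIV]) (use assms in auto)

text \<open>\<open>dX - dY\<close> is the derivative tangent to the lines x + y = s. Since
  \<open>D_minus\<close> and \<open>D_plus\<close> differentiate only in this direction,
  one-variable calculus on such a line suffices for \<open>D2\<close>.\<close>

lemma has_deriv_antidiagonal:
  "((\<lambda>x. eval2 p x (s - x)) has_field_derivative eval2 (dX p - dY p) x (s - x)) (at x)"
proof (induction p)
  case 0
  show ?case by (simp add: eval2_def dX_def dY_def)
next
  case (pCons a p)
  have Y: "eval2 (dY (pCons a p)) x y = eval2 p x y + y * eval2 (dY p) x y" for y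
    by (simp add: dY_def pderiv_pCons eval2_def)
  have "((\<lambda>x. poly a x + (s - x) * eval2 p x (s - x)) has_field_derivative
      poly (pderiv a) x + ((0 - 1) * eval2 p x (s - x) + eval2 (dX p - dY p) x (s - x) * (s - x))) (at x)"
    by (intro DERIV_add poly_DERIV DERIV_mult DERIV_diff DERIV_const DERIV_ident pCons.IH)
  then show ?case
    by (simp add: eval2_pCons dX_pCons Y algebra_simps)
qed

section \<open>The operators on symmetric polynomials\<close>

text \<open>Cancelling the nonzero factor \<open>varX - varY\<close> characterises the exact
  quotient, so later computations of \<open>D_minus\<close> never unfold \<open>div\<close>.\<close>

lemma D_minus_unique:
  assumes "sym_poly f" and "(varX - varY) * g = dY f - dX f"
  shows "D_minus f = g"
proof -
  have "(varX - varY) * D_minus f = (varX - varY) * g"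
    using D_minus_exact[OF assms(1)] assms(2) by simp
  moreover have "varX - varY \<noteq> 0"
    by (simp add: varX_def varY_def)
  ultimately show ?thesis by simp
qed

lemma eval2_D_minus:
  assumes "sym_poly f"
  shows "eval2 (dX f - dY f) x y = - (x - y) * eval2 (D_minus f) x y"
proof -
  have "eval2 ((varX - varY) * D_minus f) x y = eval2 (dY f - dX f) x y"
    using D_minus_exact[OF assms] by simp
  then show ?thesis by (simp add: algebra_simps)
qed

lemma sym_poly_sym_mono: "sym_poly (sym_mono a)"
  by (cases a) (simp add: sym_poly_def add.commute mult.commute)

lemma sym_poly_add: "sym_poly f \<Longrightarrow> sym_poly g \<Longrightarrow> sym_poly (f + g)"
  by (simp add: sym_poly_def)

lemma sym_poly_scale: "sym_poly f \<Longrightarrow> sym_poly (scale c f)"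
  by (simp add: sym_poly_def)

lemma dX_linear: "dX (f + g) = dX f + dX g" "dX (scale c f) = scale c (dX f)"
  by (auto simp: dX_def scale_def poly_eq_iff coeff_map_poly pderiv_add pderiv_smult)

lemma dY_linear: "dY (f + g) = dY f + dY g" "dY (scale c f) = scale c (dY f)"
  by (auto simp: dY_def scale_def pderiv_add pderiv_smult)

lemma scale_distrib: "scale c (f + g) = scale c f + scale c g" "scale c (f - g) = scale c f - scale c g"
  by (simp_all add: scale_def smult_add_right smult_diff_right)

lemma D2_add:
  assumes "sym_poly f" "sym_poly g"
  shows "D2 \<alpha> \<kappa> (f + g) = D2 \<alpha> \<kappa> f + D2 \<alpha> \<kappa> g"
proof -
  have "D_minus (f + g) = D_minus f + D_minus g"
    by (rule D_minus_unique)
      (use assms in \<open>auto simp: sym_poly_add D_minus_exact distrib_left dX_linear dY_linear\<close>)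
  then show ?thesis
    by (simp add: D2_def D_plus_def dX_linear dY_linear scale_distrib algebra_simps)
qed

lemma D2_scale:
  assumes "sym_poly f"
  shows "D2 \<alpha> \<kappa> (scale c f) = scale c (D2 \<alpha> \<kappa> f)"
proof -
  have "D_minus (scale c f) = scale c (D_minus f)"
  proof (rule D_minus_unique)
    show "(varX - varY) * scale c (D_minus f) = dY (scale c f) - dX (scale c f)"
      using D_minus_exact[OF assms]
      by (simp add: dX_linear dY_linear flip: scale_distrib) (simp add: scale_def)
  qed (use assms in \<open>simp add: sym_poly_scale\<close>)
  then show ?thesis
    by (intro eval2_eqI) (simp add: D2_def D_plus_def dX_linear dY_linear algebra_simps)
qed

text \<open>On the line x + y = s the factor (x + y)^n is constant, and the derivative of x(s - x)
  is s - 2x = -(x - y). For k = 0 the truncated exponent is harmless because of the factor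
  \<open>real k\<close>.\<close>

lemma eval2_deriv_sym_mono:
  "eval2 (dX (sym_mono (n, k)) - dY (sym_mono (n, k))) x y
    = - (x - y) * (real k * ((x + y) ^ n * (x * y) ^ (k - 1)))"
proof -
  define s where "s = x + y"
  have "((\<lambda>x. s ^ n * (x * (s - x)) ^ k) has_field_derivative
      s ^ n * (real k * (x * (s - x)) ^ (k - 1) * (s - 2 * x))) (at x)"
    by (rule derivative_eq_intros refl | simp)+
  with has_deriv_antidiagonal[of "sym_mono (n, k)" s x]
  have "eval2 (dX (sym_mono (n, k)) - dY (sym_mono (n, k))) x (s - x)
      = s ^ n * (real k * (x * (s - x)) ^ (k - 1) * (s - 2 * x))"
    by (intro DERIV_unique) (simp_all del: eval2_simps)
  then show ?thesis by (simp add: s_def algebra_simps)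
qed

text \<open>In the coordinates \<open>s\<close>, \<open>t\<close> the operator \<open>D\<^sub>-\<close> is \<open>\<partial>\<^sub>t\<close>.\<close>

lemma D_minus_sym_mono: "D_minus (sym_mono (n, k)) = scale (real k) (sym_mono (n, k - 1))"
proof (rule D_minus_unique[OF sym_poly_sym_mono], rule eval2_eqI)
  fix x y
  show "eval2 ((varX - varY) * scale (real k) (sym_mono (n, k - 1))) x y
    = eval2 (dY (sym_mono (n, k)) - dX (sym_mono (n, k))) x y"
    using eval2_deriv_sym_mono[of n k x y] by (simp add: algebra_simps)
qed

text \<open>Apply \<open>D_plus\<close> to k s^n t^(k-1), where s = x + y and t = xy, and substitute
  (x - y)^2 = s^2 - 4t. The diagonal coefficient collects 4k times (k - 1) + (\<kappa> + 1) +
  (\<alpha> + 1).\<close>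

lemma D2_sym_mono:
  "D2 \<alpha> \<kappa> (sym_mono (n, k)) = scale (4 * real k * (real k + \<alpha> + \<kappa> + 1)) (sym_mono (n, k))
     + scale (- (real k * (real k + \<alpha>))) (sym_mono (n + 2, k - 1))"
proof (rule eval2_eqI)
  fix x y
  define d where "d = eval2 (dX (sym_mono (n, k - 1)) - dY (sym_mono (n, k - 1))) x y"
  have d: "d = - (x - y) * (real (k - 1) * ((x + y) ^ n * (x * y) ^ (k - 1 - 1)))"
    unfolding d_def by (rule eval2_deriv_sym_mono)
  have "eval2 (D2 \<alpha> \<kappa> (sym_mono (n, k))) x y =
      real k * (x * y * (x - y) * d + 4 * (\<kappa> + 1) * (x * y * ((x + y) ^ n * (x * y) ^ (k - 1)))
        - (\<alpha> + 1) * ((x - y)\<^sup>2 * ((x + y) ^ n * (x * y) ^ (k - 1))))"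
    by (simp add: D2_def D_minus_sym_mono D_plus_def dX_linear dY_linear d_def algebra_simps)
  also have "\<dots> = 4 * real k * (real k + \<alpha> + \<kappa> + 1) * ((x + y) ^ n * (x * y) ^ k)
      - real k * (real k + \<alpha>) * ((x + y) ^ (n + 2) * (x * y) ^ (k - 1))"
  \<comment> \<open>The cases k = 0 and k = 1 are separated because \<open>k - 1\<close> and
    \<open>k - 1 - 1\<close> truncate there; the affected terms carry a factor \<open>real k\<close>
    or \<open>real (k - 1)\<close> that is zero.\<close>
  proof (cases k)
    case (Suc j)
    show ?thesis
    proof (cases j)
      case 0
      then show ?thesis unfolding d using Suc by (simp add: power2_eq_square algebra_simps)
    next
      case (Suc i)
      define P where "P = (x * y) ^ i"
      define S where "S = (x + y) ^ n"
      have "k - 1 - 1 = i" "k - 1 = Suc i" "k = Suc (Suc i)" using Suc \<open>k = Suc j\<close> by auto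
      then show ?thesis unfolding d power_Suc power_add P_def[symmetric] S_def[symmetric]
        by (simp add: power2_eq_square P_def[symmetric] S_def[symmetric] algebra_simps)
    qed
  qed auto
  finally show "eval2 (D2 \<alpha> \<kappa> (sym_mono (n, k))) x y =
    eval2 (scale (4 * real k * (real k + \<alpha> + \<kappa> + 1)) (sym_mono (n, k))
     + scale (- (real k * (real k + \<alpha>))) (sym_mono (n + 2, k - 1))) x y"
    by simp
qed

section \<open>Triangularity with respect to the symmetric degree\<close>

text \<open>The linear span of the monomials below \<open>d\<close>, generated one term at a time so
  that linear statements follow by rule induction. It contains 0, which has no symmetric
  degree.\<close>

inductive_set lower_span :: "nat \<times> nat \<Rightarrow> real poly poly set" for d where
  zero: "0 \<in> lower_span d"
| step: "f \<in> lower_span d \<Longrightarrow> a \<prec>\<^sub>s d \<Longrightarrow> f + scale c (sym_mono a) \<in> lower_span d"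

lemma lower_span_add:
  assumes "g \<in> lower_span d" "f \<in> lower_span d"
  shows "f + g \<in> lower_span d"
  using assms(1)
proof induction
  case (step g a c)
  then show ?case using lower_span.step[of "f + g" d a c] by (simp add: add.assoc)
qed (use assms in simp)

lemma lower_span_sym_mono: "a \<prec>\<^sub>s d \<Longrightarrow> scale c (sym_mono a) \<in> lower_span d"
  using lower_span.step[OF lower_span.zero] by simp

lemma lower_span_scale:
  assumes "f \<in> lower_span d"
  shows "scale c f \<in> lower_span d"
  using assms
proof induction
  case zero
  show ?case by (simp add: scale_def lower_span.zero)
next
  case (step f a b)
  have "scale c (f + scale b (sym_mono a)) = scale c f + scale (c * b) (sym_mono a)"
    by (intro eval2_eqI) (simp add: algebra_simps)
  then show ?case using step by (simp add: lower_span.step)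
qed

lemma lower_span_sum:
  assumes "\<And>a. a \<in> A \<Longrightarrow> a \<prec>\<^sub>s d"
  shows "(\<Sum>a\<in>A. scale (c a) (sym_mono a)) \<in> lower_span d"
  using assms
  by (induction A rule: infinite_finite_induct)
    (auto intro: lower_span.zero lower_span_add lower_span_sym_mono)

lemma sym_poly_lower_span: "f \<in> lower_span d \<Longrightarrow> sym_poly f"
proof (induction rule: lower_span.induct)
  case zero
  show ?case by (simp add: sym_poly_def)
qed (simp add: sym_poly_add sym_poly_scale sym_poly_sym_mono)

text \<open>The weighted degree is unchanged, (n + 2) + 2(k - 1) = n + 2k, while the second index
  drops; for k = 0 the coefficient vanishes.\<close>

lemma D2_sym_mono_lower:
  "scale (- (real k * (real k + \<alpha>))) (sym_mono (n + 2, k - 1)) \<in> lower_span (n, k)"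
proof (cases k)
  case 0
  then show ?thesis by (simp add: scale_def lower_span.zero)
next
  case Suc
  then show ?thesis by (intro lower_span_sym_mono) (simp add: prec_def)
qed

lemma prec_trans: "a \<prec>\<^sub>s b \<Longrightarrow> b \<prec>\<^sub>s c \<Longrightarrow> a \<prec>\<^sub>s c"
  by (auto simp: prec_def)

lemma lower_span_mono:
  assumes "f \<in> lower_span a" "a \<prec>\<^sub>s d"
  shows "f \<in> lower_span d"
  using assms by induction (auto intro: lower_span.intros prec_trans)

text \<open>A monomial of index \<open>a\<close> goes to a multiple of itself plus an element of
  \<open>lower_span a\<close>, and transitivity of the order puts both below
  \<open>d\<close>.\<close>

lemma D2_lower_span:
  assumes "f \<in> lower_span d"
  shows "D2 \<alpha> \<kappa> f \<in> lower_span d"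
  using assms
proof induction
  case zero
  have "D2 \<alpha> \<kappa> 0 = scale 0 (D2 \<alpha> \<kappa> 0)"
    using D2_scale[of 0 \<alpha> \<kappa> 0] by (simp add: scale_def sym_poly_def)
  then show ?case by (simp add: scale_def lower_span.zero)
next
  case (step f a c)
  obtain n k where a: "a = (n, k)" by force
  have "D2 \<alpha> \<kappa> (sym_mono a) \<in> lower_span d"
    unfolding a D2_sym_mono using step a
    by (intro lower_span_add lower_span_sym_mono lower_span_mono[OF D2_sym_mono_lower]) auto
  then show ?case
    using step sym_poly_lower_span[OF step(1)]
    by (simp add: D2_add D2_scale sym_poly_scale sym_poly_sym_mono lower_span_add lower_span_scale)
qed

text \<open>The scalar is the diagonal coefficient of \<open>D2_sym_mono\<close>, so the leading
  monomials cancel.\<close>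

lemma D2_monic:
  assumes "p = sym_mono (n, k) + g" "g \<in> lower_span (n, k)"
  shows "D2 \<alpha> \<kappa> p - scale (4 * real k * (real k + \<alpha> + \<kappa> + 1)) p \<in> lower_span (n, k)"
proof -
  let ?c = "4 * real k * (real k + \<alpha> + \<kappa> + 1)"
  have "D2 \<alpha> \<kappa> p - scale ?c p =
      scale (- (real k * (real k + \<alpha>))) (sym_mono (n + 2, k - 1)) + D2 \<alpha> \<kappa> g + scale (- ?c) g"
    using assms sym_poly_lower_span[OF assms(2)]
    by (intro eval2_eqI) (simp add: D2_add sym_poly_sym_mono D2_sym_mono algebra_simps)
  then show ?thesis
    by (simp only:) (intro lower_span_add lower_span_scale D2_lower_span D2_sym_mono_lower assms(2))
qed

section \<open>Measurability and slicing along the lines x + y = s\<close>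

lemma measurable_eval2 [measurable]:
  "f \<in> borel_measurable M \<Longrightarrow> g \<in> borel_measurable M \<Longrightarrow> (\<lambda>z. eval2 p (f z) (g z)) \<in> borel_measurable M"
proof (induction p)
  case (pCons a p)
  have "poly a \<in> borel_measurable borel"
    by (intro borel_measurable_continuous_onI continuous_intros)
  then show ?case unfolding eval2_pCons using pCons by measurable
qed simp

lemma measurable_fst_snd [measurable]:
  "(fst :: real \<times> real \<Rightarrow> real) \<in> borel_measurable borel"
  "(snd :: real \<times> real \<Rightarrow> real) \<in> borel_measurable borel"
  by (intro borel_measurable_continuous_onI continuous_intros)+

lemma measurable_triangle [measurable]: "triangle \<in> sets borel"
proof -
  have "triangle = {z. 0 \<le> fst z \<and> 0 \<le> snd z \<and> fst z + snd z \<le> 1 \<and> snd z < fst z}"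
    by (auto simp: triangle_def T2_def)
  also have "\<dots> \<in> sets borel" by measurable
  finally show ?thesis .
qed

lemma measurable_weight [measurable]: "weight \<alpha> \<gamma> \<kappa> \<in> borel_measurable borel"
  unfolding weight_def split_beta by measurable

lemma weight_nonneg: "weight \<alpha> \<gamma> \<kappa> z \<ge> 0"
  by (simp add: weight_def split_beta)

text \<open>For fixed x, translate y = s - x; then exchange the order of integration by
  Tonelli.\<close>

lemma nn_integral_shear:
  fixes h :: "real \<times> real \<Rightarrow> ennreal"
  assumes [measurable]: "h \<in> borel_measurable borel"
  shows "(\<integral>\<^sup>+z. h z \<partial>lborel) = (\<integral>\<^sup>+s. \<integral>\<^sup>+x. h (x, s - x) \<partial>lborel \<partial>lborel)"
proof -
  have m: "(\<lambda>(s, x). h (x, s - x)) \<in> borel_measurable (lborel \<Otimes>\<^sub>M lborel)"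
    by measurable
  have "(\<integral>\<^sup>+z. h z \<partial>lborel) = (\<integral>\<^sup>+x. \<integral>\<^sup>+y. h (x, y) \<partial>lborel \<partial>lborel)"
    by (subst lborel_prod[symmetric], subst lborel.nn_integral_fst) (simp_all add: lborel_prod)
  also have "\<dots> = (\<integral>\<^sup>+x. \<integral>\<^sup>+s. h (x, s - x) \<partial>lborel \<partial>lborel)"
  proof (rule nn_integral_cong)
    fix x :: real
    show "(\<integral>\<^sup>+y. h (x, y) \<partial>lborel) = (\<integral>\<^sup>+s. h (x, s - x) \<partial>lborel)"
      by (subst nn_integral_real_affine[of "\<lambda>s. h (x, s - x)" 1 x]) simp_all
  qed
  also have "\<dots> = (\<integral>\<^sup>+s. \<integral>\<^sup>+x. h (x, s - x) \<partial>lborel \<partial>lborel)"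
    using lborel_pair.Fubini[OF m] by simp
  finally show ?thesis .
qed

text \<open>Testing the nonnegative formula on indicators shows that the shear preserves Lebesgue
  measure, which makes it available for signed integrands.\<close>

lemma distr_shear: "distr lborel lborel (\<lambda>(s, x). (x, s - x)) = (lborel :: (real \<times> real) measure)"
proof (rule measure_eqI)
  fix A :: "(real \<times> real) set"
  assume "A \<in> sets (distr lborel lborel (\<lambda>(s, x). (x, s - x)))"
  then have A [measurable]: "A \<in> sets borel" by simp
  have T [measurable]: "(\<lambda>(s::real, x). (x, s - x)) \<in> borel \<rightarrow>\<^sub>M borel"
    unfolding borel_prod[symmetric] by measurable
  have "emeasure (distr lborel lborel (\<lambda>(s, x). (x, s - x))) A
      = (\<integral>\<^sup>+z. indicator A (case z of (s, x) \<Rightarrow> (x, s - x)) \<partial>lborel)"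
    by (subst nn_integral_indicator[symmetric], simp, subst nn_integral_distr) auto
  also have "\<dots> = (\<integral>\<^sup>+s. \<integral>\<^sup>+x. indicator A (x, s - x) \<partial>lborel \<partial>lborel)"
    by (subst lborel_prod[symmetric], subst lborel.nn_integral_fst[symmetric])
      (simp_all add: lborel_prod)
  also have "\<dots> = emeasure lborel A"
    by (subst nn_integral_shear[symmetric]) auto
  finally show "emeasure (distr lborel lborel (\<lambda>(s, x). (x, s - x))) A = emeasure lborel A" .
qed simp

text \<open>Transport along the measure-preserving shear, then Fubini. Fubini guarantees integrable
  slices only for almost every s.\<close>

lemma integral_shear:
  fixes h :: "real \<times> real \<Rightarrow> real"
  assumes "integrable lborel h"
  shows "AE s in lborel. integrable lborel (\<lambda>x. h (x, s - x))"
    and "(\<integral>z. h z \<partial>lborel) = (\<integral>s. \<integral>x. h (x, s - x) \<partial>lborel \<partial>lborel)"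
proof -
  have T [measurable]: "(\<lambda>(s::real, x). (x, s - x)) \<in> borel \<rightarrow>\<^sub>M borel"
    unfolding borel_prod[symmetric] by measurable
  have [measurable]: "h \<in> borel_measurable borel" using assms by auto
  have "integrable (distr lborel lborel (\<lambda>(s, x). (x, s - x))) h"
    using assms by (simp add: distr_shear)
  then have "integrable lborel (\<lambda>z. h (case z of (s, x) \<Rightarrow> (x, s - x)))"
    by (subst (asm) integrable_distr_eq) auto
  then have i: "integrable (lborel \<Otimes>\<^sub>M lborel) (\<lambda>(s, x). h (x, s - x))"
    by (simp add: lborel_prod split_beta')
  show "AE s in lborel. integrable lborel (\<lambda>x. h (x, s - x))"
    by (rule lborel_pair.AE_integrable_fst[OF i])
  have "(\<integral>z. h z \<partial>lborel) = (\<integral>z. h (case z of (s, x) \<Rightarrow> (x, s - x)) \<partial>lborel)"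
    by (subst distr_shear[symmetric], subst integral_distr) auto
  also have "\<dots> = (\<integral>s. \<integral>x. h (x, s - x) \<partial>lborel \<partial>lborel)"
    by (subst lborel_pair.integral_fst[OF i]) (simp add: lborel_prod split_beta')
  finally show "(\<integral>z. h z \<partial>lborel) = (\<integral>s. \<integral>x. h (x, s - x) \<partial>lborel \<partial>lborel)" .
qed

section \<open>Integrability of the weight\<close>

lemma nn_integral_Beta_finite:
  fixes a b :: real
  assumes "a > -1" "b > -1"
  shows "(\<integral>\<^sup>+t. ennreal (t powr a * (1 - t) powr b) * indicator {0..1} t \<partial>lborel) < \<infinity>"
proof -
  have "((\<lambda>t. t powr a * (1 - t) powr b) has_integral Beta (a + 1) (b + 1)) {0..1}"
    using has_integral_Beta_real[of "a + 1" "b + 1"] assms by simp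
  from nn_integral_has_integral_lebesgue'[OF _ this] show ?thesis by simp
qed

text \<open>Here r runs from the diagonal (r = 0) to the axis y = 0 (r = 1): x - y = sr and xy =
  s^2(1 - r^2)/4, and s/2 is the Jacobian. The weight then separates into a function of s and one of
  r. The remaining factor (1 + r)^\<alpha> has base in [1, 2], hence is at most 2^|\<alpha>| for
  either sign of \<alpha>.\<close>

lemma weight_scaled_le:
  fixes s r :: real
  assumes "0 < s" "0 < r" "r \<le> 1"
  shows "weight \<alpha> \<gamma> \<kappa> (s / 2 + s / 2 * r, s / 2 - s / 2 * r) * (s / 2)
    \<le> (2 powr \<bar>\<alpha>\<bar> / 4 powr \<alpha> / 2) * (s powr (2 * \<alpha> + 2 * \<kappa> + 2) * (1 - s) powr \<gamma>)
        * (r powr (2 * \<kappa> + 1) * (1 - r) powr \<alpha>)"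
proof -
  have s2: "(s\<^sup>2) powr \<alpha> = s powr (2 * \<alpha>)"
    using assms powr_powr[of s 2 \<alpha>] by simp
  have "(s / 2 + s / 2 * r) * (s / 2 - s / 2 * r) = s\<^sup>2 / 4 * ((1 + r) * (1 - r))"
    by (simp add: field_simps power2_eq_square)
  then have p: "((s / 2 + s / 2 * r) * (s / 2 - s / 2 * r)) powr \<alpha>
      = s powr (2 * \<alpha>) / 4 powr \<alpha> * ((1 + r) powr \<alpha> * (1 - r) powr \<alpha>)"
    using assms by (simp only:) (simp add: powr_mult powr_divide s2)
  have q: "\<bar>(s / 2 + s / 2 * r) - (s / 2 - s / 2 * r)\<bar> powr (2 * \<kappa> + 1)
      = s powr (2 * \<kappa> + 1) * r powr (2 * \<kappa> + 1)"
    using assms by (simp add: powr_mult)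
  have le: "(1 + r) powr \<alpha> \<le> 2 powr \<bar>\<alpha>\<bar>"
  proof -
    have "(1 + r) powr \<alpha> \<le> (1 + r) powr \<bar>\<alpha>\<bar>" using assms by (intro powr_mono) auto
    also have "\<dots> \<le> 2 powr \<bar>\<alpha>\<bar>" using assms by (intro powr_mono2) auto
    finally show ?thesis .
  qed
  have e: "s powr (2 * \<alpha> + 2 * \<kappa> + 2) = s powr (2 * \<alpha>) * s powr (2 * \<kappa> + 1) * s"
    using assms powr_add[of s "2 * \<alpha>" "2 * \<kappa> + 1"] powr_add[of s "2 * \<alpha> + (2 * \<kappa> + 1)" 1]
    by (simp add: algebra_simps)
  have "weight \<alpha> \<gamma> \<kappa> (s / 2 + s / 2 * r, s / 2 - s / 2 * r) * (s / 2)
      = (1 + r) powr \<alpha> * (s powr (2 * \<alpha> + 2 * \<kappa> + 2) * (1 - s) powr \<gamma>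
        * (r powr (2 * \<kappa> + 1) * (1 - r) powr \<alpha>) / 4 powr \<alpha> / 2)"
    unfolding weight_def prod.case p q e by (simp add: algebra_simps)
  also have "\<dots> \<le> 2 powr \<bar>\<alpha>\<bar> * (s powr (2 * \<alpha> + 2 * \<kappa> + 2) * (1 - s) powr \<gamma>
        * (r powr (2 * \<kappa> + 1) * (1 - r) powr \<alpha>) / 4 powr \<alpha> / 2)"
    by (intro mult_right_mono le) auto
  finally show ?thesis by (simp add: algebra_simps)
qed

text \<open>The bound separates into two Beta integrals. The one in r has exponents 2\<kappa> + 1
  and \<alpha>, the one in s has 2\<alpha> + 2\<kappa> + 2 and \<gamma>; all exceed -1 exactly under
  the four hypotheses.\<close>

lemma integrable_weight:
  assumes "\<alpha> > -1" "\<gamma> > -1" "\<kappa> > -1" "\<alpha> + \<kappa> > -3/2"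
  shows "integrable lborel (\<lambda>z. indicator triangle z * weight \<alpha> \<gamma> \<kappa> z)"
proof (rule integrableI_nonneg)
  define W where "W = (\<lambda>z. ennreal (indicator triangle z * weight \<alpha> \<gamma> \<kappa> z))"
  have [measurable]: "W \<in> borel_measurable borel" unfolding W_def by measurable
  define K where "K = 2 powr \<bar>\<alpha>\<bar> / 4 powr \<alpha> / 2"
  have K: "K \<ge> 0" by (simp add: K_def)
  define J where "J = (\<integral>\<^sup>+r. ennreal (r powr (2 * \<kappa> + 1) * (1 - r) powr \<alpha>) * indicator {0..1} r \<partial>lborel)"
  have J: "J < \<infinity>"
    unfolding J_def by (rule nn_integral_Beta_finite) (use assms in auto)
  define h where "h = (\<lambda>s::real. s powr (2 * \<alpha> + 2 * \<kappa> + 2) * (1 - s) powr \<gamma>)"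
  have inner: "(\<integral>\<^sup>+x. W (x, s - x) \<partial>lborel) \<le> (ennreal (h s) * indicator {0..1} s) * (ennreal K * J)" for s
  proof (cases "0 < s \<and> s \<le> 1")
    case True
    have "(\<integral>\<^sup>+x. W (x, s - x) \<partial>lborel)
        = ennreal (s / 2) * (\<integral>\<^sup>+r. W (s / 2 + s / 2 * r, s / 2 - s / 2 * r) \<partial>lborel)"
      by (subst nn_integral_real_affine[where c = "s / 2" and t = "s / 2"]) (use True in auto)
    also have "\<dots> = (\<integral>\<^sup>+r. ennreal (s / 2) * W (s / 2 + s / 2 * r, s / 2 - s / 2 * r) \<partial>lborel)"
      by (subst nn_integral_cmult) auto
    also have "\<dots> \<le> (\<integral>\<^sup>+r. ennreal (K * h s)
        * (ennreal (r powr (2 * \<kappa> + 1) * (1 - r) powr \<alpha>) * indicator {0..1} r) \<partial>lborel)"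
    proof (rule nn_integral_mono)
      fix r :: real
      show "ennreal (s / 2) * W (s / 2 + s / 2 * r, s / 2 - s / 2 * r) \<le> ennreal (K * h s)
        * (ennreal (r powr (2 * \<kappa> + 1) * (1 - r) powr \<alpha>) * indicator {0..1} r)"
      proof (cases "(s / 2 + s / 2 * r, s / 2 - s / 2 * r) \<in> triangle")
        case tri: True
        then have "0 < s * r" "0 \<le> s * (1 - r)" by (auto simp: triangle_def T2_def algebra_simps)
        then have r: "0 < r" "r \<le> 1" using True by (auto simp: zero_less_mult_iff zero_le_mult_iff)
        then show ?thesis
          using weight_scaled_le[of s r \<alpha> \<gamma> \<kappa>] True tri
          by (auto simp: W_def K_def h_def mult_ac weight_nonneg simp flip: ennreal_mult' intro!: ennreal_leI)
      qed (simp add: W_def)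
    qed
    also have "\<dots> = ennreal (K * h s) * J"
      unfolding J_def by (subst nn_integral_cmult) auto
    finally show ?thesis
      using True K by (simp add: ennreal_mult h_def mult_ac)
  next
    \<comment> \<open>Such a line misses \<open>triangle\<close>: 0 \<le> y < x forces s > 0, and x
      + y \<le> 1 forces s \<le> 1.\<close>
    case False
    then have "W (x, s - x) = 0" for x
      by (auto simp: W_def triangle_def T2_def indicator_def)
    then show ?thesis by simp
  qed
  have "(\<integral>\<^sup>+z. W z \<partial>lborel) = (\<integral>\<^sup>+s. \<integral>\<^sup>+x. W (x, s - x) \<partial>lborel \<partial>lborel)"
    by (rule nn_integral_shear) simp
  also have "\<dots> \<le> (\<integral>\<^sup>+s. (ennreal (h s) * indicator {0..1} s) * (ennreal K * J) \<partial>lborel)"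
    by (intro nn_integral_mono inner)
  also have "\<dots> = (\<integral>\<^sup>+s. ennreal (h s) * indicator {0..1} s \<partial>lborel) * (ennreal K * J)"
    by (rule nn_integral_multc) (simp add: h_def)
  also have "\<dots> < \<infinity>"
    using J nn_integral_Beta_finite[of "2 * \<alpha> + 2 * \<kappa> + 2" \<gamma>] assms
    by (simp add: h_def ennreal_mult_less_top)
  finally show "(\<integral>\<^sup>+z. ennreal (indicator triangle z * weight \<alpha> \<gamma> \<kappa> z) \<partial>lborel) < \<infinity>"
    by (simp add: W_def)
qed (auto simp: weight_nonneg)

text \<open>The triangle lies in the compact unit square, on which polynomials are
  continuous.\<close>

lemma eval2_bounded_triangle: "\<exists>B. \<forall>x y. (x, y) \<in> triangle \<longrightarrow> \<bar>eval2 p x y\<bar> \<le> B"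
proof -
  let ?S = "{0..1::real} \<times> {0..1::real}"
  have "continuous_on ?S (\<lambda>z. eval2 p (fst z) (snd z))"
    by (intro continuous_intros)
  then have "bounded ((\<lambda>z. eval2 p (fst z) (snd z)) ` ?S)"
    by (intro compact_imp_bounded compact_continuous_image compact_Times compact_Icc)
  then obtain B where B: "\<And>w. w \<in> (\<lambda>z. eval2 p (fst z) (snd z)) ` ?S \<Longrightarrow> norm w \<le> B"
    unfolding bounded_iff by blast
  have "\<bar>eval2 p x y\<bar> \<le> B" if "(x, y) \<in> triangle" for x y
  proof -
    have "(x, y) \<in> ?S" using that by (simp add: triangle_def T2_def)
    then have "norm (eval2 p x y) \<le> B" by (intro B image_eqI[of _ _ "(x, y)"]) simp_all
    then show ?thesis by simp
  qed
  then show ?thesis by blast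
qed

lemma integrable_eval2_weight:
  assumes "\<alpha> > -1" "\<gamma> > -1" "\<kappa> > -1" "\<alpha> + \<kappa> > -3/2"
  shows "integrable lborel (\<lambda>z. indicator triangle z * (eval2 p (fst z) (snd z) * weight \<alpha> \<gamma> \<kappa> z))"
proof -
  obtain B where B: "\<And>x y. (x, y) \<in> triangle \<Longrightarrow> \<bar>eval2 p x y\<bar> \<le> B"
    using eval2_bounded_triangle[of p] by auto
  have "integrable lborel (\<lambda>z. B * (indicator triangle z * weight \<alpha> \<gamma> \<kappa> z))"
    using integrable_weight[OF assms] by (rule integrable_mult_right)
  then show ?thesis
  proof (rule Bochner_Integration.integrable_bound)
    show "AE z in lborel. norm (indicator triangle z * (eval2 p (fst z) (snd z) * weight \<alpha> \<gamma> \<kappa> z))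
        \<le> norm (B * (indicator triangle z * weight \<alpha> \<gamma> \<kappa> z))"
    proof (rule AE_I2)
      fix z :: "real \<times> real"
      show "norm (indicator triangle z * (eval2 p (fst z) (snd z) * weight \<alpha> \<gamma> \<kappa> z))
        \<le> norm (B * (indicator triangle z * weight \<alpha> \<gamma> \<kappa> z))"
        using B[of "fst z" "snd z"] weight_nonneg[of \<alpha> \<gamma> \<kappa> z]
        by (cases z) (auto simp: indicator_def abs_mult intro!: mult_right_mono)
    qed
  qed measurable
qed

section \<open>The weighted inner product\<close>

text \<open>Merging both arguments into one polynomial brings the integrand into the form covered by
  \<open>integrable_eval2_weight\<close>.\<close>

lemma inner_w_eq:
  "inner_w \<alpha> \<gamma> \<kappa> p q = (\<integral>z. indicator triangle z * (eval2 (p * q) (fst z) (snd z) * weight \<alpha> \<gamma> \<kappa> z) \<partial>lborel)"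
  by (simp add: inner_w_def set_lebesgue_integral_def)

lemma inner_w_commute: "inner_w \<alpha> \<gamma> \<kappa> p q = inner_w \<alpha> \<gamma> \<kappa> q p"
  by (simp add: inner_w_eq mult.commute[of p q])

lemma inner_w_scale: "inner_w \<alpha> \<gamma> \<kappa> p (scale c q) = c * inner_w \<alpha> \<gamma> \<kappa> p q"
  unfolding inner_w_eq integral_mult_right_zero[symmetric]
  by (intro Bochner_Integration.integral_cong) (auto simp: algebra_simps)

context
  fixes \<alpha> \<gamma> \<kappa> :: real
  assumes params: "\<alpha> > -1" "\<gamma> > -1" "\<kappa> > -1" "\<alpha> + \<kappa> > -3/2"
begin

lemma inner_w_add: "inner_w \<alpha> \<gamma> \<kappa> p (q + r) = inner_w \<alpha> \<gamma> \<kappa> p q + inner_w \<alpha> \<gamma> \<kappa> p r"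
proof -
  have "inner_w \<alpha> \<gamma> \<kappa> p (q + r) = (\<integral>z. indicator triangle z * (eval2 (p * q) (fst z) (snd z) * weight \<alpha> \<gamma> \<kappa> z)
      + indicator triangle z * (eval2 (p * r) (fst z) (snd z) * weight \<alpha> \<gamma> \<kappa> z) \<partial>lborel)"
    unfolding inner_w_eq by (intro Bochner_Integration.integral_cong) (simp_all add: algebra_simps)
  also have "\<dots> = inner_w \<alpha> \<gamma> \<kappa> p q + inner_w \<alpha> \<gamma> \<kappa> p r"
    unfolding inner_w_eq by (intro Bochner_Integration.integral_add integrable_eval2_weight params)
  finally show ?thesis .
qed

text \<open>The nonnegative integrand vanishes almost everywhere, and the weight is positive on the
  interior \<open>U\<close>. So the open set \<open>V\<close> where \<open>q\<close> is nonzero in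
  \<open>U\<close> is null, hence empty, and \<open>q\<close> vanishes on an open set.\<close>

lemma inner_w_self_eq_0:
  assumes "inner_w \<alpha> \<gamma> \<kappa> q q = 0"
  shows "q = 0"
proof -
  define U :: "(real \<times> real) set" where "U = {z. 0 < snd z \<and> snd z < fst z \<and> fst z + snd z < 1}"
  have "open U" unfolding U_def by (intro open_Collect_conj open_Collect_less continuous_intros)
  have pos: "z \<in> triangle \<and> weight \<alpha> \<gamma> \<kappa> z > 0" if "z \<in> U" for z
    using that by (auto simp: U_def triangle_def T2_def weight_def split_beta)
  define V where "V = U \<inter> {z. eval2 q (fst z) (snd z) \<noteq> 0}"
  have V: "open V" unfolding V_def
    by (intro open_Int \<open>open U\<close> open_Collect_neq continuous_intros)
  have "AE z in lborel. indicator triangle z * (eval2 (q * q) (fst z) (snd z) * weight \<alpha> \<gamma> \<kappa> z) = 0"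
    (is "AE z in lborel. ?h z = 0")
  proof -
    have "?h z \<ge> 0" for z
      unfolding eval2_simps by (intro mult_nonneg_nonneg weight_nonneg zero_le_square) simp
    then show ?thesis
      using assms integral_nonneg_eq_0_iff_AE[OF integrable_eval2_weight[OF params, of "q * q"]]
      unfolding inner_w_eq by blast
  qed
  then have "AE z in lborel. z \<notin> V"
  proof eventually_elim
    case (elim z)
    show "z \<notin> V"
    proof
      assume "z \<in> V"
      with pos[of z] elim show False by (simp add: V_def)
    qed
  qed
  then have "V \<in> null_sets lborel"
    using V by (simp add: AE_iff_null_sets)
  then have "negligible V"
    by (simp add: negligible_iff_null_sets null_sets_completionI)
  then have "V = {}" using open_not_negligible[OF V] by blast
  show "q = 0"
  proof (rule eval2_eqI_open[OF \<open>open U\<close>])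
    have "(1/2, 1/4) \<in> U" by (simp add: U_def)
    then show "U \<noteq> {}" by blast
    show "eval2 q x y = eval2 0 x y" if "(x, y) \<in> U" for x y
      using that \<open>V = {}\<close> by (auto simp: V_def)
  qed
qed

section \<open>Self-adjointness of \<open>D2\<close>\<close>

text \<open>
  Green's identity on the segment \<open>x + y = s\<close>. The boundary terms vanish because the exponents
  \<open>\<alpha> + 1\<close> and \<open>2\<kappa> + 2\<close> are positive.
\<close>

lemma has_integral_antidiagonal:
  assumes f: "sym_poly f" and g: "sym_poly g" and s: "s > 0"
  shows "((\<lambda>x. (x * (s - x)) powr \<alpha> * (2 * x - s) powr (2 * \<kappa> + 1) *
      (eval2 (D2 \<alpha> \<kappa> f) x (s - x) * eval2 g x (s - x) - eval2 f x (s - x) * eval2 (D2 \<alpha> \<kappa> g) x (s - x)))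
      has_integral 0) {s / 2..s}"
proof -
  define a where "a = D_minus f"
  define b where "b = D_minus g"
  \<comment> \<open>\<open>E\<close> is the Wronskian of f and g formed with \<open>D_minus\<close>;
    \<open>F\<close> multiplies it by the leading coefficient of the Sturm-Liouville form.\<close>
  define E where "E = (\<lambda>x. eval2 a x (s - x) * eval2 g x (s - x) - eval2 f x (s - x) * eval2 b x (s - x))"
  define F where "F = (\<lambda>x. (x * (s - x)) powr (\<alpha> + 1) * (2 * x - s) powr (2 * \<kappa> + 2) * E x)"
  define F' where "F' = (\<lambda>x. (x * (s - x)) powr \<alpha> * (2 * x - s) powr (2 * \<kappa> + 1) *
      (eval2 (D2 \<alpha> \<kappa> f) x (s - x) * eval2 g x (s - x) - eval2 f x (s - x) * eval2 (D2 \<alpha> \<kappa> g) x (s - x)))"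
  have "(F has_vector_derivative F' x) (at x)" if x: "x \<in> {s / 2<..<s}" for x
  proof -
    define A where "A = (x * (s - x)) powr \<alpha>"
    define B where "B = (2 * x - s) powr (2 * \<kappa> + 1)"
    have pos: "x * (s - x) > 0" "2 * x - s > 0" using x s by auto
    have r: "((\<lambda>u. h u powr e) has_field_derivative e * h c powr (e - 1) * h') (at c)"
      if "(h has_field_derivative h') (at c)" "h c > 0" for h :: "real \<Rightarrow> real" and h' e c
      using DERIV_powr[OF that DERIV_const[of e]] that(2) by (simp add: powr_diff field_simps)
    have dE: "(E has_field_derivative
        (eval2 (dX a - dY a) x (s - x) * eval2 g x (s - x) + eval2 (dX g - dY g) x (s - x) * eval2 a x (s - x))
        - (eval2 (dX f - dY f) x (s - x) * eval2 b x (s - x) + eval2 (dX b - dY b) x (s - x) * eval2 f x (s - x))) (at x)"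
      unfolding E_def by (intro DERIV_diff DERIV_mult has_deriv_antidiagonal)
    have "(F has_field_derivative
        (((\<alpha> + 1) * (x * (s - x)) powr (\<alpha> + 1 - 1) * (s - 2 * x)) * (2 * x - s) powr (2 * \<kappa> + 2)
         + ((2 * \<kappa> + 2) * (2 * x - s) powr (2 * \<kappa> + 2 - 1) * 2) * (x * (s - x)) powr (\<alpha> + 1)) * E x
        + ((eval2 (dX a - dY a) x (s - x) * eval2 g x (s - x) + eval2 (dX g - dY g) x (s - x) * eval2 a x (s - x))
        - (eval2 (dX f - dY f) x (s - x) * eval2 b x (s - x) + eval2 (dX b - dY b) x (s - x) * eval2 f x (s - x)))
        * ((x * (s - x)) powr (\<alpha> + 1) * (2 * x - s) powr (2 * \<kappa> + 2))) (at x)"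
      unfolding F_def using pos
      by (intro DERIV_mult r dE) (auto intro!: derivative_eq_intros simp: algebra_simps)
    also have "(x * (s - x)) powr (\<alpha> + 1 - 1) = A" by (simp add: A_def)
    also have "(x * (s - x)) powr (\<alpha> + 1) = A * (x * (s - x))"
      using pos by (simp add: A_def powr_add)
    also have "(2 * x - s) powr (2 * \<kappa> + 2 - 1) = B" by (simp add: B_def add.commute)
    also have "(2 * x - s) powr (2 * \<kappa> + 2) = B * (2 * x - s)"
      using pos powr_add[of "2 * x - s" "2 * \<kappa> + 1" 1] by (simp add: B_def add.commute)
    \<comment> \<open>By \<open>eval2_D_minus\<close> the tangential derivatives of f and g are -(x
      - y) times \<open>a\<close> and \<open>b\<close>, so the terms in the product of
      \<open>a\<close> and \<open>b\<close> cancel; the rest assembles to \<open>D_plus\<close> of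
      \<open>a\<close> and of \<open>b\<close>.\<close>
    finally have "(F has_field_derivative F' x) (at x)"
      unfolding eval2_D_minus[OF f] eval2_D_minus[OF g] F'_def D2_def D_plus_def
      unfolding A_def[symmetric] B_def[symmetric] a_def[symmetric] b_def[symmetric] E_def
      unfolding eval2_simps by (rule DERIV_cong) (simp add: power2_eq_square algebra_simps)
    then show ?thesis by (simp add: has_real_derivative_iff_has_vector_derivative)
  qed
  moreover have "continuous_on {s / 2..s} F"
    unfolding F_def E_def using s params
    by (intro continuous_intros continuous_on_powr') auto
  \<comment> \<open>The interior form of the fundamental theorem is used because \<open>F'\<close>
    may be singular at the endpoints.\<close>
  ultimately have "(F' has_integral (F s - F (s / 2))) {s / 2..s}"
    using s by (intro fundamental_theorem_of_calculus_interior) auto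
  then show ?thesis using params by (simp add: F'_def F_def)
qed

text \<open>The difference of the two sides is integrated slice by slice. On a slice the factor (1 -
  s)^\<gamma> is constant, and what remains is Green's identity.\<close>

lemma D2_self_adjoint:
  assumes f: "sym_poly f" and g: "sym_poly g"
  shows "inner_w \<alpha> \<gamma> \<kappa> (D2 \<alpha> \<kappa> f) g = inner_w \<alpha> \<gamma> \<kappa> f (D2 \<alpha> \<kappa> g)"
proof -
  define H where "H = (\<lambda>z. indicator triangle z *
    (eval2 (D2 \<alpha> \<kappa> f * g - f * D2 \<alpha> \<kappa> g) (fst z) (snd z) * weight \<alpha> \<gamma> \<kappa> z))"
  have iH: "integrable lborel H"
    unfolding H_def by (intro integrable_eval2_weight params)
  \<comment> \<open>Green's identity yields a gauge integral; integrability of the slice identifies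
    it with the Lebesgue integral.\<close>
  have slice: "(\<integral>x. H (x, s - x) \<partial>lborel) = 0" if i: "integrable lborel (\<lambda>x. H (x, s - x))" for s
  proof (cases "0 < s \<and> s \<le> 1")
    case True
    define G where "G = (\<lambda>x. (x * (s - x)) powr \<alpha> * (2 * x - s) powr (2 * \<kappa> + 1) *
      (eval2 (D2 \<alpha> \<kappa> f) x (s - x) * eval2 g x (s - x) - eval2 f x (s - x) * eval2 (D2 \<alpha> \<kappa> g) x (s - x)))"
    have "H (x, s - x) = (if x \<in> {s / 2..s} then (1 - s) powr \<gamma> * G x else 0)" for x
    \<comment> \<open>This endpoint lies on the diagonal, outside \<open>triangle\<close> but inside
      the closed interval. Both sides are 0 there, since \<open>0 powr e = 0\<close> for every
      exponent.\<close>
    proof (cases "x = s / 2")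
      case False
      with True have "(x, s - x) \<in> triangle \<longleftrightarrow> x \<in> {s / 2..s}"
        by (auto simp: triangle_def T2_def)
      then show ?thesis
        by (auto simp: H_def G_def weight_def abs_of_nonneg algebra_simps)
    qed (auto simp: H_def G_def triangle_def)
    moreover have "((\<lambda>x. (1 - s) powr \<gamma> * G x) has_integral (1 - s) powr \<gamma> * 0) {s / 2..s}"
      unfolding G_def using True f g by (intro has_integral_mult_right has_integral_antidiagonal) auto
    ultimately have "((\<lambda>x. H (x, s - x)) has_integral 0) UNIV"
      by (simp only: has_integral_restrict_UNIV mult_zero_right)
    then show ?thesis
      using has_integral_integral_lborel[OF i] has_integral_unique by blast
  next
    case False
    then have "H (x, s - x) = 0" for x
      by (auto simp: H_def triangle_def T2_def indicator_def)
    then show ?thesis by simp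
  qed
  from integral_shear(1)[OF iH] have "AE s in lborel. (\<integral>x. H (x, s - x) \<partial>lborel) = 0"
    by eventually_elim (rule slice)
  then have "(\<integral>z. H z \<partial>lborel) = 0"
    unfolding integral_shear(2)[OF iH] by (rule integral_eq_zero_AE)
  moreover have "(\<integral>z. H z \<partial>lborel) = inner_w \<alpha> \<gamma> \<kappa> (D2 \<alpha> \<kappa> f) g - inner_w \<alpha> \<gamma> \<kappa> f (D2 \<alpha> \<kappa> g)"
  proof -
    have "(\<integral>z. H z \<partial>lborel) = (\<integral>z. indicator triangle z * (eval2 (D2 \<alpha> \<kappa> f * g) (fst z) (snd z) * weight \<alpha> \<gamma> \<kappa> z)
        - indicator triangle z * (eval2 (f * D2 \<alpha> \<kappa> g) (fst z) (snd z) * weight \<alpha> \<gamma> \<kappa> z) \<partial>lborel)"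
      unfolding H_def by (intro Bochner_Integration.integral_cong) (simp_all add: algebra_simps)
    also have "\<dots> = inner_w \<alpha> \<gamma> \<kappa> (D2 \<alpha> \<kappa> f) g - inner_w \<alpha> \<gamma> \<kappa> f (D2 \<alpha> \<kappa> g)"
      unfolding inner_w_eq by (intro Bochner_Integration.integral_diff integrable_eval2_weight params)
    finally show ?thesis .
  qed
  ultimately show ?thesis by simp
qed

section \<open>The eigenvalue equation\<close>

text \<open>Each monomial has its own index as symmetric degree, so the defining orthogonality
  applies to it; linearity extends this to the span, including 0.\<close>

lemma monic_orthogonal_lower_span:
  assumes "is_monic_orthogonal \<alpha> \<gamma> \<kappa> d p" "f \<in> lower_span d"
  shows "inner_w \<alpha> \<gamma> \<kappa> p f = 0"
  using assms(2)
proof induction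
  case zero
  show ?case by (simp add: inner_w_eq)
next
  case (step f a c)
  have "has_sym_degree (sym_mono a) a"
    unfolding has_sym_degree_def
    by (rule exI[of _ "\<lambda>b. if b = a then 1 else 0"]) (simp add: scale_def flip: one_pCons)
  then have "inner_w \<alpha> \<gamma> \<kappa> p (sym_mono a) = 0"
    using assms(1) step(2) sym_poly_sym_mono unfolding is_monic_orthogonal_def by blast
  with step show ?case by (simp add: inner_w_add inner_w_scale)
qed

lemma D2_monic_orthogonal:
  assumes p: "is_monic_orthogonal \<alpha> \<gamma> \<kappa> (n, k) p"
  shows "D2 \<alpha> \<kappa> p = scale (4 * real k * (real k + \<alpha> + \<kappa> + 1)) p"
proof -
  define c where "c = 4 * real k * (real k + \<alpha> + \<kappa> + 1)"
  define q where "q = D2 \<alpha> \<kappa> p - scale c p"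
  have "q \<in> lower_span (n, k)"
    using p unfolding is_monic_orthogonal_def q_def c_def
    by (auto intro!: D2_monic[OF refl] lower_span_sum)
  \<comment> \<open>The pairing of \<open>q\<close> with \<open>D2 \<alpha> \<kappa> p\<close> is
    evaluated twice. Expanding gives the square of \<open>q\<close> plus c times its pairing with
    \<open>p\<close>, which is 0; self-adjointness gives the pairing of \<open>p\<close> with
    \<open>D2 \<alpha> \<kappa> q\<close>, also 0 because that polynomial stays in the lower
    span.\<close>
  have "D2 \<alpha> \<kappa> p = q + scale c p" by (simp add: q_def)
  then have "inner_w \<alpha> \<gamma> \<kappa> q (D2 \<alpha> \<kappa> p) = inner_w \<alpha> \<gamma> \<kappa> q q + c * inner_w \<alpha> \<gamma> \<kappa> q p"
    by (simp add: inner_w_add inner_w_scale)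
  moreover have "inner_w \<alpha> \<gamma> \<kappa> q (D2 \<alpha> \<kappa> p) = inner_w \<alpha> \<gamma> \<kappa> p (D2 \<alpha> \<kappa> q)"
    using p sym_poly_lower_span[OF \<open>q \<in> _\<close>] D2_self_adjoint[of q p] D2_self_adjoint[of p q]
    by (simp add: is_monic_orthogonal_def inner_w_commute)
  ultimately have "inner_w \<alpha> \<gamma> \<kappa> q q = 0"
    using monic_orthogonal_lower_span[OF p] D2_lower_span \<open>q \<in> _\<close>
    by (simp add: inner_w_commute[of _ _ _ q p])
  then have "q = 0" by (rule inner_w_self_eq_0)
  then show ?thesis by (simp add: q_def c_def)
qed

end

theorem corollary5p4:
  fixes \<alpha> \<gamma> \<kappa> :: real
    and p :: "nat \<Rightarrow> nat \<Rightarrow> real poly poly"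
  assumes "\<alpha> > -1" "\<gamma> > -1" "\<kappa> > -1" "\<alpha> + \<kappa> > -3/2"
    and "\<And>n k. is_monic_orthogonal \<alpha> \<gamma> \<kappa> (n, k) (p n k)"
  shows "\<forall>n k. D2 \<alpha> \<kappa> (p n k) = scale (4 * real k * (real k + \<alpha> + \<kappa> + 1)) (p n k)"
  using D2_monic_orthogonal[OF assms(1-4)] assms(5) by blast

end
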